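(* Let $n\ge 2$ and let $S\subseteq \mathbb{Z}_n$ with $0\notin S$. Then the mixed circulant graph $\mathrm{Circ}(\mathbb{Z}_n,S)$ is HS-integral if and only if there exist sets $\mathscr{D}_1\subseteq\{d: d\mid n\}$ and $\mathscr{D}_2\subseteq\{d: d\mid \frac n3\}$ (the latter being relevant only when $n\equiv 0 \pmod 3$) with $\mathscr{D}_1\cap\mathscr{D}_2=\emptyset$, and a choice $S_n(d)\in\{G_{n,3}^1(d),G_{n,3}^2(d)\}$ for each $d\in\mathscr{D}_2$, such that $$S\setminus\overline{S}=\bigcup_{d\in\mathscr{D}_1}G_n(d)\qquad\text{and}\qquad \overline{S}=\begin{cases}\emptyset & \text{if } n\not\equiv 0 \pmod 3,\\ \bigcup_{d\in\mathscr{D}_2}S_n(d) & \text{if } n\equiv 0 \pmod 3.\end{cases}$$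
   Context: Elements of $\mathbb{Z}_n$ are identified with $0,1,\dots,n-1$. For $S\subseteq\mathbb{Z}_n$ with $0\notin S$, $\overline{S}=\{u\in S: -u\notin S\}$. The mixed circulant graph $\mathrm{Circ}(\mathbb{Z}_n,S)$ has vertex set $\mathbb{Z}_n$ and directed edge set $\{(a,b): b-a\in S\}$. Its Hermitian-adjacency matrix of the second kind is $\mathcal{H}=(h_{uv})$ with $h_{uv}=1$ if both $(u,v)$ and $(v,u)$ are edges, $h_{uv}=\frac{1+i\sqrt3}{2}$ if only $(u,v)$ is an edge, $h_{uv}=\frac{1-i\sqrt3}{2}$ if only $(v,u)$ is an edge, and $h_{uv}=0$ otherwise. The graph is HS-integral if all eigenvalues of $\mathcal{H}$ are integers. All divisors are positive. For $d\mid n$, $G_n(d)=\{dk: 1\le dk\le n-1,\ \gcd(dk,n)=d\}$ (so $G_n(n)=\emptyset$). For $n\equiv 0\pmod 3$, $d\mid\frac n3$ and $r\in\{1,2\}$, $G_{n,3}^r(d)=\{dk: 1\le dk\le n-1,\ \gcd(dk,n)=d,\ k\equiv r\pmod 3\}$. *)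

theory Defs
  imports Complex_Main "Jordan_Normal_Form.Char_Poly" "Graph_Theory.Pair_Digraph"
begin

text \<open>
  The elements of \<open>\<int>\<^sub>n\<close> are represented by the natural numbers \<open>0, \<dots>, n - 1\<close>.  All definitions
  below are meant for \<open>n > 0\<close> and arguments in \<open>{0..<n}\<close>; the inner subtraction in
  \<open>zn_minus\<close> then does not truncate.
\<close>

definition zn_minus :: "nat \<Rightarrow> nat \<Rightarrow> nat \<Rightarrow> nat" where
  "zn_minus n a b = (a + (n - b)) mod n"

definition zn_neg :: "nat \<Rightarrow> nat \<Rightarrow> nat" where
  "zn_neg n u = zn_minus n 0 u"

definition skew_part :: "nat \<Rightarrow> nat set \<Rightarrow> nat set" where
  "skew_part n S = {u \<in> S. zn_neg n u \<notin> S}"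

definition circ :: "nat \<Rightarrow> nat set \<Rightarrow> nat pair_pre_digraph" where
  "circ n S = \<lparr> pverts = {0..<n},
                parcs = {(a, b). a \<in> {0..<n} \<and> b \<in> {0..<n} \<and> zn_minus n b a \<in> S} \<rparr>"

text \<open>
  The matrix is defined for graphs whose vertex set is an initial segment \<open>{0..<n}\<close> of the naturals,
  so that vertices serve directly as row and column indices.
\<close>

definition hermitian_adj2 :: "nat pair_pre_digraph \<Rightarrow> complex mat" where
  "hermitian_adj2 G = mat (card (pverts G)) (card (pverts G)) (\<lambda>(u, v).
     if (u, v) \<in> parcs G \<and> (v, u) \<in> parcs G then 1
     else if (u, v) \<in> parcs G then (1 + \<i> * complex_of_real (sqrt 3)) / 2
     else if (v, u) \<in> parcs G then (1 - \<i> * complex_of_real (sqrt 3)) / 2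
     else 0)"

definition HS_integral :: "nat pair_pre_digraph \<Rightarrow> bool" where
  "HS_integral G \<longleftrightarrow> (\<forall>ev. eigenvalue (hermitian_adj2 G) ev \<longrightarrow> ev \<in> \<int>)"

definition G_set :: "nat \<Rightarrow> nat \<Rightarrow> nat set" where
  "G_set n d = {d * k | k. 1 \<le> d * k \<and> d * k \<le> n - 1 \<and> gcd (d * k) n = d}"

definition G3_set :: "nat \<Rightarrow> nat \<Rightarrow> nat \<Rightarrow> nat set" where
  "G3_set n r d =
     {d * k | k. 1 \<le> d * k \<and> d * k \<le> n - 1 \<and> gcd (d * k) n = d \<and> k mod 3 = r mod 3}"

end

theory Submission
  imports Defs "HOL-Number_Theory.Cong"
begin

text \<open>
  Let \<open>c\<close> be the function on \<open>\<int>\<^sub>n\<close> with \<open>h\<^sub>u\<^sub>v = c (v - u)\<close>; its values are \<open>0\<close>, \<open>1\<close>, \<open>\<omega>\<close> and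
  \<open>cnj \<omega>\<close>, where \<open>\<omega>\<close> is a primitive sixth root of unity, and \<open>c = 1\<close> exactly on the symmetric part of
  \<open>S\<close> while \<open>c = \<omega>\<close> exactly on its skew part.  The matrix is circulant, so its eigenvalues are the
  values \<open>\<lambda>\<^sub>j\<close> of the discrete Fourier transform of \<open>c\<close> (lemma \<open>eigenvalue_circ_iff\<close>), and the
  question is for which \<open>c\<close> this transform takes integer values.

  If \<open>S\<close> has the described shape, then on each class \<open>{t. gcd t n = d}\<close> the function \<open>c\<close> is \<open>0\<close>, or
  \<open>1\<close>, or, because \<open>- \<omega>\<close> is a cube root of unity, the negative of a character of \<open>\<int>\<^sub>n\<close>
  (lemma \<open>skew_symbol_conv_zeta\<close>).  Hence every \<open>\<lambda>\<^sub>j\<close> is a signed sum of Ramanujan sums, and these are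
  integers (lemma \<open>Ramanujan_sum_int\<close>).

  Conversely, let all \<open>\<lambda>\<^sub>j\<close> be integers.  The key is that then \<open>c (a t) = c t ^ a\<close> for all \<open>a\<close> coprime
  to \<open>6 n\<close> (lemma \<open>hs_symbol_mult_coprime\<close>).  This is what the Galois automorphism \<open>\<zeta> \<mapsto> \<zeta> ^ a\<close> yields
  when applied to the inversion formula for \<open>n c t\<close>; a Frobenius congruence serves here in place of
  the automorphism.  It is enough to treat a prime \<open>a = p\<close>.  The \<open>p\<close>-th power map is additive modulo
  \<open>p\<close> in \<open>\<int>[\<zeta>]\<close>, so the inversion formula gives \<open>n c (p t) \<equiv> n c t ^ p\<close> modulo \<open>p\<close>.  Two different
  values among \<open>0, 1, \<omega>, cnj \<omega>\<close> have a difference of norm \<open>1\<close> or \<open>3\<close>, which leaves no room for a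
  factor \<open>p\<close>, so the congruence is an equality (lemma \<open>hs_symbol_Frobenius\<close>).

  Any two elements of a class \<open>{t. gcd t n = d}\<close> are carried into each other, modulo \<open>n\<close>, by a factor
  \<open>a\<close> coprime to \<open>6 n\<close>.  Hence the value \<open>1\<close> propagates to the whole class, while the value \<open>\<omega>\<close> is kept
  by the factors \<open>a \<equiv> 1\<close> modulo \<open>3\<close> and turned into \<open>cnj \<omega>\<close> by the others.  If \<open>3\<close> did not divide
  \<open>n div d\<close>, some factor \<open>a \<equiv> 2\<close> modulo \<open>3\<close> would fix \<open>t\<close>, whence \<open>\<omega> = cnj \<omega>\<close>.
\<close>

section \<open>Roots of unity\<close>

definition zeta :: "nat \<Rightarrow> int \<Rightarrow> complex" where
  "zeta n k = cis (2 * pi * of_int k / of_nat n)"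

lemma zeta_0 [simp]: "zeta n 0 = 1"
  by (simp add: zeta_def)

lemma zeta_add: "zeta n (k + l) = zeta n k * zeta n l"
  by (simp add: zeta_def cis_mult add_divide_distrib algebra_simps)

lemma zeta_power: "zeta n k ^ m = zeta n (k * int m)"
  by (simp add: zeta_def DeMoivre mult_ac)

lemma cnj_zeta: "cnj (zeta n k) = zeta n (- k)"
  by (simp add: zeta_def cis_cnj)

lemma zeta_scale: "m > 0 \<Longrightarrow> zeta (m * n) (int m * k) = zeta n k"
  by (simp add: zeta_def field_simps)

lemma zeta_eq_1_iff:
  assumes "n > 0"
  shows "zeta n k = 1 \<longleftrightarrow> int n dvd k"
proof
  assume "zeta n k = 1"
  then have "cos (2 * pi * of_int k / of_nat n) = 1"
    by (simp add: zeta_def complex_eq_iff)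
  then obtain x :: int where "2 * pi * of_int k / of_nat n = of_int x * 2 * pi"
    by (auto simp: cos_one_2pi_int)
  then have "real_of_int k = of_int (x * int n)"
    using assms by (simp add: field_simps)
  then have "k = x * int n" by (simp only: of_int_eq_iff)
  then show "int n dvd k" by simp
next
  assume "int n dvd k"
  then obtain x where k: "k = int n * x" by (elim dvdE)
  show "zeta n k = 1"
    using cis_multiple_2pi[of "of_int x"] assms by (simp add: zeta_def k mult_ac)
qed

lemma zeta_cong:
  assumes "n > 0" "int n dvd k - l"
  shows "zeta n k = zeta n l"
  using zeta_add[of n "k - l" l] assms zeta_eq_1_iff[of n "k - l"] by simp

lemma zeta_mod: "n > 0 \<Longrightarrow> zeta n (k mod int n) = zeta n k"
  by (rule zeta_cong) (simp_all add: minus_mod_eq_mult_div [symmetric] mod_eq_dvd_iff [symmetric])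

lemma sum_zeta:
  assumes "n > 0"
  shows "(\<Sum>j<n. zeta n (int j * k)) = (if int n dvd k then of_nat n else 0)"
proof (cases "int n dvd k")
  case True
  then have "zeta n (int j * k) = 1" for j
    using assms by (simp add: zeta_eq_1_iff)
  then show ?thesis using True by simp
next
  case False
  have "zeta n k ^ n = 1" "zeta n k \<noteq> 1"
    using False assms by (simp_all add: zeta_power zeta_eq_1_iff)
  then have "(\<Sum>j<n. zeta n k ^ j) = 0"
    by (simp add: geometric_sum)
  moreover have "(\<Sum>j<n. zeta n (int j * k)) = (\<Sum>j<n. zeta n k ^ j)"
    by (simp add: zeta_power mult.commute)
  ultimately have "(\<Sum>j<n. zeta n (int j * k)) = 0" by simp
  then show ?thesis using False by simp
qed

text \<open>
  A sum over a full period may be re-indexed by any affine map with leading coefficient \<open>\<plusminus> 1\<close>; this is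
  how the row sums of a circulant matrix turn into Fourier transforms.
\<close>

lemma sum_periodic_reflect:
  fixes f :: "int \<Rightarrow> 'a :: comm_monoid_add"
  assumes "n > 0" and per: "\<And>x. f (x mod int n) = f x"
  shows "(\<Sum>v<n. f (a - int v)) = (\<Sum>v<n. f (int v))"
proof -
  let ?r = "\<lambda>v. nat ((a - int v) mod int n)"
  show ?thesis
  proof (rule sum.reindex_bij_witness[of _ ?r ?r])
    fix v assume v: "v \<in> {..<n}"
    show "?r (?r v) = v" "?r (?r v) = v"
      using v \<open>n > 0\<close> by (simp_all add: mod_simps)
    show "?r v \<in> {..<n}" "?r v \<in> {..<n}"
      using \<open>n > 0\<close> by (simp_all add: nat_less_iff)
    show "f (int (?r v)) = f (a - int v)"
      using \<open>n > 0\<close> by (simp add: per)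
  qed
qed

lemma sum_periodic_shift:
  fixes f :: "int \<Rightarrow> 'a :: comm_monoid_add"
  assumes "n > 0" and per: "\<And>x. f (x mod int n) = f x"
  shows "(\<Sum>v<n. f (int v - a)) = (\<Sum>v<n. f (int v))"
proof -
  have "(\<Sum>v<n. f (int v - a)) = (\<Sum>v<n. f (- (a - int v)))" by simp
  also have "\<dots> = (\<Sum>v<n. f (- int v))"
    using assms by (intro sum_periodic_reflect[of n "\<lambda>x. f (- x)"]) (metis mod_minus_eq)+
  also have "\<dots> = (\<Sum>v<n. f (int v))"
    using sum_periodic_reflect[of n f 0] assms by simp
  finally show ?thesis .
qed

section \<open>The ring generated by a root of unity\<close>

definition cyc_ring :: "nat \<Rightarrow> complex set" where
  "cyc_ring N = range (\<lambda>p :: int poly. poly (of_int_poly p) (zeta N 1))"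

lemma cyc_ring_of_int: "of_int a \<in> cyc_ring N"
  unfolding cyc_ring_def
  by (rule range_eqI[of _ _ "[:a:]"]) (cases "a = 0", simp_all add: map_poly_pCons)

lemma cyc_ring_of_nat: "of_nat a \<in> cyc_ring N"
  using cyc_ring_of_int[of "int a"] by simp

lemma cyc_ring_add: "x \<in> cyc_ring N \<Longrightarrow> y \<in> cyc_ring N \<Longrightarrow> x + y \<in> cyc_ring N"
  unfolding cyc_ring_def
  by (auto simp: image_iff) (metis of_int_poly_hom.hom_add poly_add)

lemma cyc_ring_mult: "x \<in> cyc_ring N \<Longrightarrow> y \<in> cyc_ring N \<Longrightarrow> x * y \<in> cyc_ring N"
  unfolding cyc_ring_def
  by (auto simp: image_iff) (metis of_int_poly_hom.hom_mult poly_mult)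

lemma cyc_ring_power: "x \<in> cyc_ring N \<Longrightarrow> x ^ k \<in> cyc_ring N"
  using cyc_ring_of_int[of 1] by (induction k) (auto intro: cyc_ring_mult)

lemma cyc_ring_diff: "x \<in> cyc_ring N \<Longrightarrow> y \<in> cyc_ring N \<Longrightarrow> x - y \<in> cyc_ring N"
  using cyc_ring_add[of x N "of_int (- 1) * y"] cyc_ring_mult[OF cyc_ring_of_int[of "- 1"]] by simp

lemma cyc_ring_sum: "(\<And>i. i \<in> A \<Longrightarrow> f i \<in> cyc_ring N) \<Longrightarrow> sum f A \<in> cyc_ring N"
  using cyc_ring_of_int[of 0] by (induction A rule: infinite_finite_induct) (auto intro: cyc_ring_add)

lemma cyc_ring_zeta:
  assumes "N > 0"
  shows "zeta N k \<in> cyc_ring N"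
proof -
  have "zeta N 1 \<in> cyc_ring N"
    unfolding cyc_ring_def by (rule range_eqI[of _ _ "[:0, 1:]"]) (simp add: map_poly_pCons)
  moreover have "zeta N 1 ^ nat (k mod int N) = zeta N k"
    using assms by (simp add: zeta_power zeta_mod)
  ultimately show ?thesis by (metis cyc_ring_power)
qed

lemma cyc_ring_cnj:
  assumes "N > 0" "x \<in> cyc_ring N"
  shows "cnj x \<in> cyc_ring N"
proof -
  obtain p :: "int poly" where x: "x = poly (of_int_poly p) (zeta N 1)"
    using assms(2) by (auto simp: cyc_ring_def)
  have "cnj x = (\<Sum>i\<le>degree p. of_int (Polynomial.coeff p i) * zeta N (- int i))"
    by (simp add: x poly_altdef cnj_zeta zeta_power)
  then show ?thesis
    using assms(1) by (auto intro!: cyc_ring_sum cyc_ring_mult cyc_ring_of_int cyc_ring_zeta)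
qed

text \<open>
  Multiplication by \<open>x \<in> \<int>[\<zeta>]\<close> takes each of the powers \<open>1, \<zeta>, \<dots>, \<zeta> ^ (N - 1)\<close> to an integer
  combination of them.  The vector of these powers is thus an eigenvector, with eigenvalue \<open>x\<close>, of an
  integer matrix, whose characteristic polynomial is monic and integral.
\<close>

lemma cyc_ring_imp_algebraic_int:
  assumes "N > 0" "x \<in> cyc_ring N"
  shows "algebraic_int x"
proof -
  obtain p :: "int poly" where x: "x = poly (of_int_poly p) (zeta N 1)"
    using assms(2) by (auto simp: cyc_ring_def)
  define A :: "int mat" where
    "A = mat N N (\<lambda>(i, k). \<Sum>j\<le>degree p. if (i + j) mod N = k then Polynomial.coeff p j else 0)"
  define M :: "complex mat" where "M = map_mat of_int A"
  define v where "v = vec N (\<lambda>i. zeta N (int i))"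
  have M: "M \<in> carrier_mat N N" and A: "A \<in> carrier_mat N N"
    by (auto simp: M_def A_def)
  have "M *\<^sub>v v = x \<cdot>\<^sub>v v"
  proof (rule eq_vecI)
    fix i assume "i < dim_vec (x \<cdot>\<^sub>v v)"
    then have i: "i < N" by (simp add: v_def)
    have "(M *\<^sub>v v) $ i = (\<Sum>k<N. of_int (\<Sum>j\<le>degree p. if (i + j) mod N = k then Polynomial.coeff p j else 0) * zeta N (int k))"
      using i by (simp add: M_def A_def v_def scalar_prod_def lessThan_atLeast0)
    also have "\<dots> = (\<Sum>k<N. \<Sum>j\<le>degree p. if (i + j) mod N = k then of_int (Polynomial.coeff p j) * zeta N (int k) else 0)"
      by (auto simp: sum_distrib_right intro!: sum.cong)
    also have "\<dots> = (\<Sum>j\<le>degree p. \<Sum>k<N. if (i + j) mod N = k then of_int (Polynomial.coeff p j) * zeta N (int k) else 0)"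
      by (rule sum.swap)
    also have "\<dots> = (\<Sum>j\<le>degree p. of_int (Polynomial.coeff p j) * zeta N (int ((i + j) mod N)))"
      using \<open>N > 0\<close> by (intro sum.cong) (auto simp: sum.delta')
    also have "\<dots> = (\<Sum>j\<le>degree p. of_int (Polynomial.coeff p j) * zeta N (int j)) * zeta N (int i)"
      using \<open>N > 0\<close> by (simp add: zmod_int zeta_mod zeta_add sum_distrib_left sum_distrib_right mult_ac)
    also have "\<dots> = x * zeta N (int i)"
      by (simp add: x poly_altdef zeta_power)
    finally show "(M *\<^sub>v v) $ i = (x \<cdot>\<^sub>v v) $ i"
      using i by (simp add: v_def)
  qed (simp add: M_def A_def v_def)
  moreover have "v \<noteq> 0\<^sub>v N"
  proof
    assume "v = 0\<^sub>v N"
    then have "v $ 0 = 0" using \<open>N > 0\<close> by simp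
    then show False using \<open>N > 0\<close> by (simp add: v_def)
  qed
  ultimately have "eigenvalue M x"
    using M unfolding eigenvalue_def eigenvector_def by (intro exI[of _ v]) (auto simp: v_def)
  then have "poly (char_poly M) x = 0"
    using eigenvalue_root_char_poly[OF M] by simp
  moreover have "char_poly M = of_int_poly (char_poly A)"
    unfolding M_def by (rule of_int_hom.char_poly_hom[OF A])
  moreover have "lead_coeff (char_poly M) = 1"
    using degree_monic_char_poly[OF M] by simp
  ultimately show ?thesis
    by (intro algebraic_int.intros[of "char_poly M"]) auto
qed

lemma cyc_ring_rational:
  assumes "N > 0" "x \<in> cyc_ring N" "x \<in> \<rat>"
  shows "x \<in> \<int>"
  using rational_algebraic_int_is_int[OF cyc_ring_imp_algebraic_int] assms by blast

text \<open>
  Congruence modulo \<open>p\<close> in \<open>\<int>[\<zeta>]\<close>; the two sides themselves may lie outside the ring.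
\<close>

definition cyc_cong :: "nat \<Rightarrow> nat \<Rightarrow> complex \<Rightarrow> complex \<Rightarrow> bool" where
  "cyc_cong N p x y \<longleftrightarrow> (\<exists>b\<in>cyc_ring N. x - y = of_nat p * b)"

lemma cyc_cong_refl: "cyc_cong N p x x"
  unfolding cyc_cong_def using cyc_ring_of_int[of 0] by force

lemma cyc_cong_trans: "cyc_cong N p x y \<Longrightarrow> cyc_cong N p y z \<Longrightarrow> cyc_cong N p x z"
  unfolding cyc_cong_def
  by (metis (no_types, opaque_lifting) cyc_ring_add diff_add_cancel add_diff_eq distrib_left)

lemma cyc_cong_sym: "cyc_cong N p x y \<Longrightarrow> cyc_cong N p y x"
  unfolding cyc_cong_def
  by (metis cyc_ring_diff cyc_ring_of_int diff_0 minus_diff_eq mult_minus_right of_int_0)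

lemma cyc_cong_add: "cyc_cong N p x y \<Longrightarrow> cyc_cong N p x' y' \<Longrightarrow> cyc_cong N p (x + x') (y + y')"
  unfolding cyc_cong_def by (metis cyc_ring_add add_diff_add distrib_left)

lemma cyc_cong_mult_right: "cyc_cong N p x y \<Longrightarrow> z \<in> cyc_ring N \<Longrightarrow> cyc_cong N p (x * z) (y * z)"
  unfolding cyc_cong_def by (metis cyc_ring_mult left_diff_distrib mult.assoc)

lemma cyc_cong_sum:
  "(\<And>i. i \<in> A \<Longrightarrow> cyc_cong N p (f i) (g i)) \<Longrightarrow> cyc_cong N p (sum f A) (sum g A)"
  by (induction A rule: infinite_finite_induct) (auto intro: cyc_cong_add cyc_cong_refl)

lemma cyc_cong_add_power:
  assumes p: "prime p" and x: "x \<in> cyc_ring N" and y: "y \<in> cyc_ring N"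
  shows "cyc_cong N p ((x + y) ^ p) (x ^ p + y ^ p)"
proof -
  have "p > 0" using p prime_gt_0_nat by blast
  have "{..p} = insert 0 (insert p {1..<p})" using \<open>p > 0\<close> by auto
  then have "(x + y) ^ p - (x ^ p + y ^ p)
      = (\<Sum>k\<in>{1..<p}. of_nat (p choose k) * x ^ k * y ^ (p - k))"
    using \<open>p > 0\<close> by (simp add: binomial_ring)
  also have "\<dots> = of_nat p * (\<Sum>k\<in>{1..<p}. of_nat ((p choose k) div p) * x ^ k * y ^ (p - k))"
    unfolding sum_distrib_left
  proof (rule sum.cong)
    fix k assume "k \<in> {1..<p}"
    then have "p dvd (p choose k)"
      using p by (intro dvd_choose_prime) auto
    then have "(of_nat (p choose k) :: complex) = of_nat p * of_nat ((p choose k) div p)"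
      by (metis dvd_mult_div_cancel of_nat_mult)
    then show "of_nat (p choose k) * x ^ k * y ^ (p - k)
        = of_nat p * (of_nat ((p choose k) div p) * x ^ k * y ^ (p - k))" by simp
  qed simp
  finally show ?thesis
    unfolding cyc_cong_def
    by (rule bexI) (intro cyc_ring_sum cyc_ring_mult cyc_ring_power cyc_ring_of_nat x y)
qed

lemma cyc_cong_sum_power:
  assumes p: "prime p" and f: "\<And>i. i \<in> A \<Longrightarrow> f i \<in> cyc_ring N"
  shows "cyc_cong N p (sum f A ^ p) (\<Sum>i\<in>A. f i ^ p)"
  using f
proof (induction A rule: infinite_finite_induct)
  case (insert i A)
  have "cyc_cong N p ((f i + sum f A) ^ p) (f i ^ p + sum f A ^ p)"
    using insert.prems by (intro cyc_cong_add_power p cyc_ring_sum) auto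
  moreover have "cyc_cong N p (f i ^ p + sum f A ^ p) (f i ^ p + (\<Sum>i\<in>A. f i ^ p))"
    by (rule cyc_cong_add [OF cyc_cong_refl insert.IH]) (simp add: insert.prems)
  ultimately show ?case using insert.hyps by (auto intro: cyc_cong_trans)
qed (use p prime_gt_0_nat in \<open>auto simp: cyc_cong_refl zero_power\<close>)

text \<open>
  Fermat's congruence is the additivity of the \<open>p\<close>-th power applied to \<open>1 + \<dots> + 1\<close>.
\<close>

lemma cyc_cong_nat_power:
  assumes p: "prime p"
  shows "cyc_cong N p (of_nat a ^ p) (of_nat a)"
  using cyc_cong_sum_power[OF p, of "{..<a}" "\<lambda>_. 1" N] cyc_ring_of_int[of 1] by simp

lemma cyc_cong_int_power:
  assumes p: "prime p" "odd p"
  shows "cyc_cong N p (of_int a ^ p) (of_int a)"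
proof (cases "a \<ge> 0")
  case True
  then show ?thesis using cyc_cong_nat_power[OF p(1), of N "nat a"] by simp
next
  case False
  then have "of_int a = (of_int (- 1) :: complex) * of_nat (nat (- a))" by simp
  then show ?thesis
    using cyc_cong_mult_right[OF cyc_cong_nat_power[OF p(1), of N "nat (- a)"] cyc_ring_of_int[of "- 1"]] p
    by (simp add: power_mult_distrib power_minus_odd)
qed

section \<open>The values of the matrix entries\<close>

abbreviation hs_unit :: complex where "hs_unit \<equiv> zeta 6 1"

lemma hs_unit_eq: "hs_unit = (1 + \<i> * complex_of_real (sqrt 3)) / 2"
proof -
  have "2 * pi / 6 = pi / 3" by simp
  then show ?thesis
    by (simp add: zeta_def complex_eq_iff cos_60 sin_60)
qed

lemma cnj_hs_unit_eq: "cnj hs_unit = (1 - \<i> * complex_of_real (sqrt 3)) / 2"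
  by (simp add: hs_unit_eq complex_eq_iff)

lemma zeta_3_conv_hs_unit: "zeta 3 (- 1) = - hs_unit"
proof -
  have "zeta 6 3 = - 1" by (simp add: zeta_def complex_eq_iff)
  then have "zeta 6 (- 2) * (- 1) = hs_unit"
    using zeta_add[of 6 "- 2" 3] by simp
  moreover have "zeta 6 (- 2) = zeta 3 (- 1)"
    using zeta_scale[of 2 3 "- 1"] by simp
  ultimately show ?thesis by (metis minus_minus mult_minus1_right)
qed

definition hs_values :: "complex set" where
  "hs_values = {0, 1, hs_unit, cnj hs_unit}"

lemma hs_unit_distinct:
  "hs_unit \<noteq> 0" "hs_unit \<noteq> 1" "cnj hs_unit \<noteq> 0" "cnj hs_unit \<noteq> 1" "hs_unit \<noteq> cnj hs_unit"
  by (simp_all add: hs_unit_eq complex_eq_iff)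

lemma hs_values_power:
  assumes "x \<in> hs_values" "coprime a 6"
  shows "x ^ a = (if a mod 3 = 1 then x else cnj x)"
proof -
  have "\<not> 2 dvd a" "\<not> 3 dvd a"
    using assms(2) coprime_common_divisor_nat[of a 6 2] coprime_common_divisor_nat[of a 6 3] by auto
  then have a: "a mod 6 = 1 \<and> a mod 3 = 1 \<or> a mod 6 = 5 \<and> a mod 3 = 2" by presburger
  then have "a > 0" by (cases a) auto
  have "hs_unit ^ a = zeta 6 (int (a mod 6))"
    by (simp add: zeta_power zmod_int zeta_mod[of 6, simplified])
  moreover have "zeta 6 5 = cnj hs_unit"
    unfolding cnj_zeta by (rule zeta_cong) auto
  ultimately have "hs_unit ^ a = (if a mod 3 = 1 then hs_unit else cnj hs_unit)"
    using a by auto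
  moreover from this have "cnj hs_unit ^ a = (if a mod 3 = 1 then cnj hs_unit else hs_unit)"
    by (simp flip: complex_cnj_power)
  ultimately show ?thesis
    using assms(1) \<open>a > 0\<close> by (auto simp: hs_values_def)
qed

lemma cnj_in_hs_values: "x \<in> hs_values \<Longrightarrow> cnj x \<in> hs_values"
  by (auto simp: hs_values_def)

text \<open>
  The values lie in the Eisenstein integers, and two distinct ones differ by a unit or, in the case of
  \<open>hs_unit\<close> and its conjugate, by \<open>\<plusminus> \<i> * sqrt 3\<close>.
\<close>

lemma hs_values_diff_norm:
  assumes "x \<in> hs_values" "y \<in> hs_values"
  shows "x = y \<or> (x - y) * cnj (x - y) = 1 \<or> (x - y) * cnj (x - y) = 3"
proof -
  have cnj: "cnj hs_unit = 1 - hs_unit"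
    by (simp add: hs_unit_eq complex_eq_iff)
  have sq: "hs_unit * hs_unit = hs_unit - 1"
    by (simp add: hs_unit_eq complex_eq_iff)
  show ?thesis
    using assms unfolding hs_values_def
    by (elim insertE emptyE; hypsubst; simp add: cnj sq algebra_simps)
qed

section \<open>The symbol and the eigenvalues of the circulant matrix\<close>

text \<open>
  The symbol takes integer arguments, so that differences of vertices and negation need no truncation;
  it depends on the argument modulo \<open>n\<close> only.
\<close>

definition hs_symbol :: "nat \<Rightarrow> nat set \<Rightarrow> int \<Rightarrow> complex" where
  "hs_symbol n S t =
    (let fwd = nat (t mod int n) \<in> S; bwd = nat (- t mod int n) \<in> S in
     if fwd \<and> bwd then 1 else if fwd then hs_unit else if bwd then cnj hs_unit else 0)"

lemma hs_symbol_mod [simp]: "hs_symbol n S (t mod int n) = hs_symbol n S t"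
  by (simp add: hs_symbol_def mod_minus_eq)

lemma hs_symbol_cong: "t mod int n = u mod int n \<Longrightarrow> hs_symbol n S t = hs_symbol n S u"
  by (metis hs_symbol_mod)

lemma hs_symbol_minus: "hs_symbol n S (- t) = cnj (hs_symbol n S t)"
  by (simp add: hs_symbol_def Let_def)

lemma hs_symbol_in_hs_values: "hs_symbol n S t \<in> hs_values"
  by (simp add: hs_symbol_def hs_values_def Let_def)

lemma zn_minus_conv_int:
  assumes "v < n" "u < n"
  shows "zn_minus n v u = nat ((int v - int u) mod int n)"
proof -
  have "int (v + (n - u)) = int v - int u + int n" using assms by simp
  then have "int (zn_minus n v u) = (int v - int u) mod int n"
    unfolding zn_minus_def zmod_int by (simp only: mod_add_self2)
  then show ?thesis by linarith
qed

lemma zn_neg_conv_int: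
  assumes "u < n"
  shows "zn_neg n u = nat (- int u mod int n)"
  unfolding zn_neg_def using assms by (subst zn_minus_conv_int) auto

lemma skew_part_iff_hs_symbol:
  assumes "t < n"
  shows "t \<in> skew_part n S \<longleftrightarrow> hs_symbol n S (int t) = hs_unit"
  using assms hs_unit_distinct
  by (auto simp: skew_part_def hs_symbol_def Let_def zn_neg_conv_int)

lemma sym_part_iff_hs_symbol:
  assumes "t < n"
  shows "t \<in> S - skew_part n S \<longleftrightarrow> hs_symbol n S (int t) = 1"
  using assms hs_unit_distinct
  by (auto simp: skew_part_def hs_symbol_def Let_def zn_neg_conv_int)

lemma hermitian_adj2_circ_index:
  assumes "u < n" "v < n"
  shows "hermitian_adj2 (circ n S) $$ (u, v) = hs_symbol n S (int v - int u)"
  using assms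
  unfolding hermitian_adj2_def hs_unit_eq [symmetric] cnj_hs_unit_eq [symmetric]
  by (simp add: circ_def hs_symbol_def Let_def zn_minus_conv_int)

definition hs_eig :: "nat \<Rightarrow> nat set \<Rightarrow> int \<Rightarrow> complex" where
  "hs_eig n S j = (\<Sum>t<n. hs_symbol n S (int t) * zeta n (j * int t))"

lemma hs_symbol_zeta_periodic:
  "n > 0 \<Longrightarrow> hs_symbol n S (x mod int n) * zeta n (j * (x mod int n)) = hs_symbol n S x * zeta n (j * x)"
  by (metis hs_symbol_mod mod_mult_right_eq zeta_mod)

text \<open>
  The characters of \<open>\<int>\<^sub>n\<close> are eigenvectors.  That no other eigenvalues occur holds because the
  characters are also left eigenvectors: pairing an arbitrary eigenvector \<open>x\<close> with the \<open>j\<close>-th character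
  gives \<open>ev * y j = hs_eig n S j * y j\<close>, and some \<open>y j\<close> is nonzero since the Fourier transform is
  injective.
\<close>

lemma eigenvalue_circ_iff:
  assumes "n > 0"
  shows "eigenvalue (hermitian_adj2 (circ n S)) ev \<longleftrightarrow> (\<exists>j<n. ev = hs_eig n S (int j))"
proof -
  define H where "H = hermitian_adj2 (circ n S)"
  have H: "H \<in> carrier_mat n n"
    by (simp add: H_def hermitian_adj2_def circ_def)
  have mult: "(H *\<^sub>v x) $ u = (\<Sum>v<n. hs_symbol n S (int v - int u) * x $ v)"
    if "u < n" "x \<in> carrier_vec n" for x u
  proof -
    have "(H *\<^sub>v x) $ u = (\<Sum>v<n. H $$ (u, v) * x $ v)"
      using that H by (simp add: scalar_prod_def lessThan_atLeast0)
    then show ?thesis using that(1) by (simp add: H_def hermitian_adj2_circ_index)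
  qed
  note per = hs_symbol_zeta_periodic[OF assms, of S]
  show ?thesis
    unfolding H_def [symmetric]
  proof
    assume "eigenvalue H ev"
    then obtain x where x: "x \<in> carrier_vec n" "x \<noteq> 0\<^sub>v n" and ev: "H *\<^sub>v x = ev \<cdot>\<^sub>v x"
      using H by (auto simp: eigenvalue_def eigenvector_def)
    define y where "y j = (\<Sum>u<n. x $ u * zeta n (- (int j * int u)))" for j
    have y: "ev * y j = hs_eig n S (int j) * y j" for j
    proof -
      have inner: "(\<Sum>u<n. hs_symbol n S (int v - int u) * zeta n (- (int j * int u)))
          = zeta n (- (int j * int v)) * hs_eig n S (int j)" for v
      proof -
        have "zeta n (- (int j * int u)) = zeta n (- (int j * int v)) * zeta n (int j * (int v - int u))" for u
          by (simp add: algebra_simps flip: zeta_add)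
        then have "(\<Sum>u<n. hs_symbol n S (int v - int u) * zeta n (- (int j * int u)))
          = zeta n (- (int j * int v)) *
            (\<Sum>u<n. hs_symbol n S (int v - int u) * zeta n (int j * (int v - int u)))"
          by (simp add: sum_distrib_left mult_ac)
        also have "(\<Sum>u<n. hs_symbol n S (int v - int u) * zeta n (int j * (int v - int u)))
            = hs_eig n S (int j)"
          unfolding hs_eig_def
          by (rule sum_periodic_reflect[of n "\<lambda>t. hs_symbol n S t * zeta n (int j * t)"])
             (use assms per in auto)
        finally show ?thesis .
      qed
      have "ev * y j = (\<Sum>u<n. (ev \<cdot>\<^sub>v x) $ u * zeta n (- (int j * int u)))"
        using x by (simp add: y_def sum_distrib_left mult_ac)
      also have "\<dots> = (\<Sum>u<n. \<Sum>v<n. hs_symbol n S (int v - int u) * x $ v * zeta n (- (int j * int u)))"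
        unfolding ev [symmetric] using mult x by (simp add: sum_distrib_right)
      also have "\<dots> = (\<Sum>v<n. x $ v * (\<Sum>u<n. hs_symbol n S (int v - int u) * zeta n (- (int j * int u))))"
        by (subst sum.swap) (simp add: sum_distrib_left mult_ac)
      also have "\<dots> = hs_eig n S (int j) * y j"
        unfolding inner y_def sum_distrib_left by (simp add: mult_ac)
      finally show ?thesis .
    qed
    have "\<exists>j<n. y j \<noteq> 0"
    proof (rule ccontr)
      assume "\<not> (\<exists>j<n. y j \<noteq> 0)"
      then have y0: "y j = 0" if "j < n" for j using that by blast
      have "x $ v = 0" if v: "v < n" for v
      proof -
        have "0 = (\<Sum>j<n. y j * zeta n (int j * int v))" using y0 by simp
        also have "\<dots> = (\<Sum>j<n. \<Sum>u<n. x $ u * zeta n (int j * (int v - int u)))"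
          by (simp add: y_def sum_distrib_right mult.assoc right_diff_distrib flip: zeta_add)
        also have "\<dots> = (\<Sum>u<n. x $ u * (\<Sum>j<n. zeta n (int j * (int v - int u))))"
          by (subst sum.swap) (simp add: sum_distrib_left)
        also have "\<dots> = (\<Sum>u<n. if u = v then x $ u * of_nat n else 0)"
        proof (rule sum.cong)
          fix u assume "u \<in> {..<n}"
          then have "int n dvd int v - int u \<longleftrightarrow> u = v"
            using v by (auto simp: mod_eq_dvd_iff [symmetric])
          then show "x $ u * (\<Sum>j<n. zeta n (int j * (int v - int u)))
              = (if u = v then x $ u * of_nat n else 0)"
            using assms by (simp add: sum_zeta)
        qed simp
        also have "\<dots> = x $ v * of_nat n" using v by simp
        finally show ?thesis using assms by simp
      qed
      then have "x = 0\<^sub>v n" using x by (intro eq_vecI) auto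
      with x show False by simp
    qed
    then show "\<exists>j<n. ev = hs_eig n S (int j)" using y by auto
  next
    assume "\<exists>j<n. ev = hs_eig n S (int j)"
    then obtain j where j: "ev = hs_eig n S (int j)" by blast
    define x where "x = vec n (\<lambda>v. zeta n (int j * int v))"
    have x: "x \<in> carrier_vec n" by (simp add: x_def)
    have "H *\<^sub>v x = ev \<cdot>\<^sub>v x"
    proof (rule eq_vecI)
      fix u assume "u < dim_vec (ev \<cdot>\<^sub>v x)"
      then have u: "u < n" by (simp add: x_def)
      have shift: "zeta n (int j * int v) = zeta n (int j * int u) * zeta n (int j * (int v - int u))" for v
        by (simp add: algebra_simps flip: zeta_add)
      have "(H *\<^sub>v x) $ u = (\<Sum>v<n. hs_symbol n S (int v - int u) * zeta n (int j * int v))"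
        using mult[OF u x] by (simp add: x_def)
      also have "\<dots> = (\<Sum>v<n. zeta n (int j * int u) *
          (hs_symbol n S (int v - int u) * zeta n (int j * (int v - int u))))"
        by (intro sum.cong refl) (subst shift, simp only: mult_ac)
      also have "\<dots> = zeta n (int j * int u) *
          (\<Sum>v<n. hs_symbol n S (int v - int u) * zeta n (int j * (int v - int u)))"
        by (rule sum_distrib_left [symmetric])
      also have "(\<Sum>v<n. hs_symbol n S (int v - int u) * zeta n (int j * (int v - int u))) = ev"
        unfolding j hs_eig_def
        by (rule sum_periodic_shift[of n "\<lambda>t. hs_symbol n S t * zeta n (int j * t)"])
           (use assms per in auto)
      finally show "(H *\<^sub>v x) $ u = (ev \<cdot>\<^sub>v x) $ u"
        using u by (simp add: x_def)
    qed (use H in \<open>simp add: x_def\<close>)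
    moreover have "x \<noteq> 0\<^sub>v n"
    proof
      assume "x = 0\<^sub>v n"
      then have "x $ 0 = 0" using assms by simp
      then show False using assms by (simp add: x_def)
    qed
    ultimately show "eigenvalue H ev"
      using H x unfolding eigenvalue_def eigenvector_def by auto
  qed
qed

lemma HS_integral_circ_iff:
  "n > 0 \<Longrightarrow> HS_integral (circ n S) \<longleftrightarrow> (\<forall>j<n. hs_eig n S (int j) \<in> \<int>)"
  by (auto simp: HS_integral_def eigenvalue_circ_iff)

lemma hs_symbol_inversion:
  assumes "n > 0"
  shows "of_nat n * hs_symbol n S t = (\<Sum>j<n. hs_eig n S (int j) * zeta n (- (int j * t)))"
proof -
  have "(\<Sum>j<n. hs_eig n S (int j) * zeta n (- (int j * t)))
      = (\<Sum>j<n. \<Sum>s<n. hs_symbol n S (int s) * zeta n (int j * (int s - t)))"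
    by (simp add: hs_eig_def sum_distrib_right mult.assoc right_diff_distrib flip: zeta_add)
  also have "\<dots> = (\<Sum>s<n. hs_symbol n S (int s) * (\<Sum>j<n. zeta n (int j * (int s - t))))"
    by (subst sum.swap) (simp add: sum_distrib_left)
  also have "\<dots> = (\<Sum>s<n. if s = nat (t mod int n) then hs_symbol n S (int s) * of_nat n else 0)"
  proof (rule sum.cong)
    fix s assume "s \<in> {..<n}"
    then have "int n dvd int s - t \<longleftrightarrow> s = nat (t mod int n)"
      using assms by (auto simp: mod_eq_dvd_iff [symmetric])
    then show "hs_symbol n S (int s) * (\<Sum>j<n. zeta n (int j * (int s - t)))
        = (if s = nat (t mod int n) then hs_symbol n S (int s) * of_nat n else 0)"
      using assms by (simp add: sum_zeta)
  qed simp
  also have "\<dots> = of_nat n * hs_symbol n S t"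
    using assms by (simp add: nat_less_iff)
  finally show ?thesis by simp
qed

section \<open>Integral eigenvalues and the action of units\<close>

text \<open>
  Both sides of the congruence come from the \<open>p\<close>-th power of \<open>n * c = (\<Sum>j. l j * z j)\<close>: on the right
  the \<open>p\<close>-th power passes to the summands, where it fixes \<open>l j\<close> modulo \<open>p\<close> and multiplies the exponent
  in \<open>z j\<close> by \<open>p\<close>, which gives \<open>n * c'\<close>; on the left it gives \<open>n * c ^ p\<close>.  A congruence between two
  different values contradicts the norm computation, as \<open>p\<^sup>2\<close> would divide \<open>n\<^sup>2\<close> or \<open>3 n\<^sup>2\<close>, where
  \<open>p\<close> divides neither \<open>3\<close> nor \<open>n\<close>.
\<close>

lemma hs_symbol_Frobenius:
  assumes "n > 0" and int: "\<forall>j<n. hs_eig n S (int j) \<in> \<int>"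
    and p: "prime p" "coprime p (6 * n)"
  shows "hs_symbol n S (int p * t) = hs_symbol n S t ^ p"
proof (rule ccontr)
  assume neq: "hs_symbol n S (int p * t) \<noteq> hs_symbol n S t ^ p"
  \<comment> \<open>The factor 6 puts the values of the symbol into the ring together with the \<open>n\<close>-th roots of unity.\<close>
  define N where "N = 6 * n"
  have "N > 0" using \<open>n > 0\<close> by (simp add: N_def)
  have p6: "coprime p 6" "coprime p n" using p(2) by simp_all
  have "odd p"
    using coprime_common_divisor_nat[OF p6(1), of 2] by auto
  have "p \<noteq> 3"
    using coprime_common_divisor_nat[OF p6(1), of 3] by auto
  define c where "c = hs_symbol n S t"
  define c' where "c' = hs_symbol n S (int p * t)"
  have zeta_n: "zeta n k \<in> cyc_ring N" for k
    using cyc_ring_zeta[OF \<open>N > 0\<close>, of "6 * k"] zeta_scale[of 6 n k] by (simp add: N_def)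
  have "hs_unit \<in> cyc_ring N"
    using cyc_ring_zeta[OF \<open>N > 0\<close>, of "int n"] zeta_scale[of n 6 1] \<open>n > 0\<close>
    by (simp add: N_def mult.commute)
  then have ring: "x \<in> cyc_ring N" if "x \<in> hs_values" for x
    using that cyc_ring_of_int[of 0 N] cyc_ring_of_int[of 1 N] cyc_ring_cnj[OF \<open>N > 0\<close>]
    by (auto simp: hs_values_def)
  have c: "c \<in> hs_values" "c' \<in> hs_values" "c ^ p \<in> hs_values"
    using hs_values_power[of c p] p6 cnj_in_hs_values
    by (auto simp: c_def c'_def hs_symbol_in_hs_values)
  have "\<forall>j. \<exists>m. j < n \<longrightarrow> hs_eig n S (int j) = of_int m"
    using int by (auto elim: Ints_cases)
  then obtain l where l: "\<And>j. j < n \<Longrightarrow> hs_eig n S (int j) = of_int (l j)"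
    using choice [of "\<lambda>j m. j < n \<longrightarrow> hs_eig n S (int j) = of_int m"] by blast
  define z where "z j = zeta n (- (int j * t))" for j
  have "of_nat n * c = (\<Sum>j<n. of_int (l j) * z j)"
    unfolding c_def z_def hs_symbol_inversion[OF \<open>n > 0\<close>] using l by simp
  moreover have "cyc_cong N p ((\<Sum>j<n. of_int (l j) * z j) ^ p) (\<Sum>j<n. (of_int (l j) * z j) ^ p)"
    by (intro cyc_cong_sum_power p cyc_ring_mult cyc_ring_of_int) (simp add: z_def zeta_n)
  moreover have "cyc_cong N p (\<Sum>j<n. (of_int (l j) * z j) ^ p) (\<Sum>j<n. of_int (l j) * z j ^ p)"
    unfolding power_mult_distrib
    by (intro cyc_cong_sum cyc_cong_mult_right cyc_cong_int_power cyc_ring_power p \<open>odd p\<close>)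
       (simp add: z_def zeta_n)
  moreover have "(\<Sum>j<n. of_int (l j) * z j ^ p) = of_nat n * c'"
    unfolding c'_def z_def hs_symbol_inversion[OF \<open>n > 0\<close>]
    by (rule sum.cong) (simp_all add: l zeta_power mult_ac)
  ultimately have "cyc_cong N p ((of_nat n * c) ^ p) (of_nat n * c')"
    by (metis cyc_cong_trans)
  moreover have "cyc_cong N p ((of_nat n * c) ^ p) (of_nat n * c ^ p)"
    unfolding power_mult_distrib
    by (intro cyc_cong_mult_right cyc_cong_nat_power p ring c)
  ultimately have "cyc_cong N p (of_nat n * c') (of_nat n * c ^ p)"
    by (metis cyc_cong_trans cyc_cong_sym)
  then obtain b where b: "b \<in> cyc_ring N" "of_nat n * (c' - c ^ p) = of_nat p * b"
    by (auto simp: cyc_cong_def right_diff_distrib)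
  \<comment> \<open>Multiplying by the conjugate turns the equation in the ring into one between integers.\<close>
  obtain e :: nat where e: "e = 1 \<or> e = 3" "(c' - c ^ p) * cnj (c' - c ^ p) = of_nat e"
    using hs_values_diff_norm[OF c(2,3)] neq unfolding c_def c'_def
    by (metis of_nat_1 of_nat_numeral)
  have "of_nat (n\<^sup>2 * e) = (of_nat n * (c' - c ^ p)) * cnj (of_nat n * (c' - c ^ p))"
    using e(2) by (simp add: power2_eq_square mult_ac)
  also have "\<dots> = of_nat (p\<^sup>2) * (b * cnj b)"
    unfolding b(2) by (simp add: power2_eq_square mult_ac)
  finally have eq: "of_nat (n\<^sup>2 * e) = of_nat (p\<^sup>2) * (b * cnj b)" .
  have "p > 0" using p(1) prime_gt_0_nat by blast
  then have "b * cnj b = of_nat (n\<^sup>2 * e) / of_nat (p\<^sup>2)"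
    unfolding eq by simp
  then have "b * cnj b \<in> \<rat>" by simp
  then have "b * cnj b \<in> \<int>"
    using b(1) \<open>N > 0\<close> by (intro cyc_ring_rational cyc_ring_mult cyc_ring_cnj)
  then obtain m where "b * cnj b = of_int m" by (elim Ints_cases)
  then have "(of_int (int (n\<^sup>2 * e)) :: complex) = of_int (int (p\<^sup>2) * m)"
    using eq by simp
  then have "int (n\<^sup>2 * e) = int (p\<^sup>2) * m"
    by (simp only: of_int_eq_iff)
  then have "int (p\<^sup>2) dvd int (n\<^sup>2 * e)" by simp
  then have "p\<^sup>2 dvd n\<^sup>2 * e" by (simp only: of_nat_dvd_iff)
  then have "p dvd n\<^sup>2 * e" by (metis dvd_mult_left power2_eq_square)
  moreover have "\<not> p dvd n\<^sup>2"
    using p(1) p6(2) by (metis coprime_absorb_left not_prime_unit prime_dvd_power)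
  ultimately have "p dvd e" using p(1) by (simp add: prime_dvd_mult_iff)
  then have "p dvd 3" using e(1) p(1) by auto
  then have "p = 3" using p(1) by (intro primes_dvd_imp_eq) simp_all
  then show False using \<open>p \<noteq> 3\<close> by simp
qed

lemma hs_symbol_mult_coprime:
  assumes "n > 0" and int: "\<forall>j<n. hs_eig n S (int j) \<in> \<int>"
    and a: "coprime a (6 * n)"
  shows "hs_symbol n S (int a * t) = hs_symbol n S t ^ a"
  using a
proof (induction a rule: less_induct)
  case (less a)
  show ?case
  proof (cases "a = 1")
    case False
    then obtain p where p: "prime p" "p dvd a" using prime_factor_nat by blast
    then obtain b where ab: "a = p * b" by (elim dvdE)
    have cop: "coprime p (6 * n)" "coprime b (6 * n)" using less.prems by (simp_all add: ab)
    have "a \<noteq> 0" using less.prems \<open>n > 0\<close> by (cases "a = 0") auto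
    then have "b < a" using prime_gt_1_nat[OF p(1)] by (simp add: ab)
    have "hs_symbol n S (int a * t) = hs_symbol n S (int p * (int b * t))"
      by (simp add: ab mult_ac)
    also have "\<dots> = hs_symbol n S (int b * t) ^ p"
      by (rule hs_symbol_Frobenius) (use assms p cop in auto)
    also have "\<dots> = hs_symbol n S t ^ a"
      using less.IH[OF \<open>b < a\<close> cop(2)] by (simp add: ab mult.commute flip: power_mult)
    finally show ?thesis .
  qed simp
qed

section \<open>Lifting units\<close>

text \<open>
  Adding to \<open>a\<close> the product of \<open>m\<close> and of exactly those primes of \<open>L\<close> that do not divide \<open>a\<close> works: a
  prime of \<open>L\<close> then divides exactly one of the two summands.
\<close>

lemma coprime_lift:
  fixes a m L :: nat
  assumes "coprime a m" "L > 0"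
  shows "\<exists>b. [b = a] (mod m) \<and> coprime b L"
proof (intro exI conjI)
  define P where "P = {p \<in> prime_factors L. \<not> p dvd a}"
  let ?b = "a + m * \<Prod>P"
  show "[?b = a] (mod m)" by (simp add: cong_def)
  have fin: "finite P" by (simp add: P_def)
  show "coprime ?b L"
  proof (rule ccontr)
    assume "\<not> coprime ?b L"
    then have "gcd ?b L \<noteq> 1" by (simp add: coprime_iff_gcd_eq_1)
    then obtain p where "prime p" "p dvd gcd ?b L" using prime_factor_nat by blast
    then have p: "prime p" "p dvd ?b" "p dvd L" by simp_all
    show False
    proof (cases "p dvd a")
      case True
      then have "p dvd m * \<Prod>P" using p(2) by (simp add: dvd_add_right_iff)
      moreover have "\<not> p dvd m"
        using True assms(1) p(1) by (meson coprime_common_divisor not_prime_unit)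
      ultimately obtain q where "q \<in> P" "p dvd q"
        using p(1) fin by (auto simp: prime_dvd_mult_iff prime_dvd_prod_iff)
      then have "p = q" using p(1) by (intro primes_dvd_imp_eq) (auto simp: P_def)
      with \<open>q \<in> P\<close> True show False by (simp add: P_def)
    next
      case False
      then have "p \<in> P" using p assms(2) by (auto simp: P_def prime_factors_dvd)
      then have "p dvd m * \<Prod>P" using dvd_prodI[OF fin, of p id] by simp
      then show False using False p(2) by (metis dvd_add_left_iff)
    qed
  qed
qed

lemma unit_transport:
  fixes k k' m L :: nat
  assumes "coprime k m" "coprime k' m" "L > 0"
  shows "\<exists>a. coprime a L \<and> [a * k = k'] (mod m)"
proof -
  obtain i where i: "[k * i = 1] (mod m)"
    using cong_solve_coprime_nat[OF assms(1)] by auto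
  then have "coprime i m"
    by (metis cong_imp_coprime cong_sym coprime_1_left coprime_mult_left_iff)
  then have "coprime (i * k') m" using assms(2) by simp
  then obtain a where a: "[a = i * k'] (mod m)" "coprime a L"
    using coprime_lift assms(3) by blast
  have "[a * k = k * i * k'] (mod m)"
    using cong_scalar_right[OF a(1), of k] by (simp add: mult_ac)
  also have "[k * i * k' = 1 * k'] (mod m)"
    by (rule cong_scalar_right) (rule i)
  finally show ?thesis using a(2) by auto
qed

section \<open>Classes of equal greatest common divisor\<close>

lemma G_set_conv: "G_set n d = {t. 1 \<le> t \<and> t \<le> n - 1 \<and> gcd t n = d}"
proof (intro equalityI subsetI)
  fix t assume t: "t \<in> {t. 1 \<le> t \<and> t \<le> n - 1 \<and> gcd t n = d}"
  then have "d dvd t" by auto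
  then obtain k where k: "t = d * k" by (elim dvdE)
  have "1 \<le> t" "t \<le> n - 1" "gcd t n = d" using t by simp_all
  then have "1 \<le> d * k" "d * k \<le> n - 1" "gcd (d * k) n = d" unfolding k .
  then show "t \<in> G_set n d" unfolding G_set_def k by blast
qed (auto simp: G_set_def)

lemma G_setE:
  assumes "n > 0" "t \<in> G_set n d"
  obtains k where "t = d * k" "t < n" "0 < k" "d > 0" "d dvd n" "coprime k (n div d)"
proof -
  obtain k where k: "t = d * k" "1 \<le> t" "t \<le> n - 1" "gcd t n = d"
    using assms(2) by (auto simp: G_set_def)
  have "d dvd n" using k(4) by auto
  then have "d * gcd k (n div d) = d"
    using k(1,4) by (simp add: gcd_mult_distrib_nat)
  moreover have "d > 0" "k > 0" using k(1,2) by (cases d; cases k; simp)+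
  ultimately have "coprime k (n div d)" by (simp add: coprime_iff_gcd_eq_1)
  with that k \<open>d dvd n\<close> \<open>d > 0\<close> \<open>k > 0\<close> assms(1) show ?thesis by force
qed

lemma G_set_reflect:
  assumes "t \<in> G_set n d"
  shows "n - t \<in> G_set n d"
proof -
  have "1 \<le> t" "t \<le> n - 1" "gcd t n = d" using assms by (auto simp: G_set_conv)
  moreover from this have "gcd (n - t) n = d"
    by (metis (no_types, lifting) diff_diff_cancel diff_le_self gcd.commute gcd_diff1_nat gcd_diff2_nat le_trans)
  ultimately show ?thesis by (auto simp: G_set_conv)
qed

lemma G3_set_conv:
  assumes "d > 0"
  shows "d * k \<in> G3_set n r d \<longleftrightarrow> d * k \<in> G_set n d \<and> k mod 3 = r mod 3"
  using assms by (auto simp: G3_set_def G_set_def)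

lemma G3_set_subset: "G3_set n r d \<subseteq> G_set n d"
  by (auto simp: G3_set_def G_set_def)

text \<open>
  The sum over all multiples of \<open>d\<close> is a full geometric sum, hence \<open>0\<close> or \<open>n div d\<close>.  It is also the
  sum of the Ramanujan sums for the multiples \<open>e\<close> of \<open>d\<close> dividing \<open>n\<close>, so downward induction on \<open>d\<close>
  isolates the one for \<open>d\<close> itself.
\<close>

lemma Ramanujan_sum_int:
  assumes "n > 0" "d dvd n"
  shows "(\<Sum>t | t \<in> {1..n} \<and> gcd t n = d. zeta n (j * int t)) \<in> \<int>"
  using assms(2)
proof (induction "n - d" arbitrary: d rule: less_induct)
  case less
  let ?A = "\<lambda>d. {t \<in> {1..n}. gcd t n = d}"
  let ?s = "\<lambda>A. \<Sum>t\<in>A. zeta n (j * int t)"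
  obtain m where m: "n = d * m" using less.prems by (elim dvdE)
  then have "d > 0" "m > 0" using assms(1) by auto
  define E where "E = {e. d dvd e \<and> e dvd n \<and> e \<noteq> d}"
  have fin: "finite E" using assms(1) unfolding E_def by (auto intro: finite_subset[of _ "{..n}"] dvd_imp_le)
  have E_int: "?s (?A e) \<in> \<int>" if "e \<in> E" for e
  proof (rule less.hyps)
    have "d \<le> e" "e \<noteq> d" "e \<le> n" using that assms(1) by (auto simp: E_def dvd_imp_le dvd_pos_nat)
    then show "n - e < n - d" by linarith
    show "e dvd n" using that by (simp add: E_def)
  qed
  have split: "{t \<in> {1..n}. d dvd t} = ?A d \<union> (\<Union>e\<in>E. ?A e)"
  proof (intro equalityI subsetI)
    fix t assume t: "t \<in> {t \<in> {1..n}. d dvd t}"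
    then have "d dvd gcd t n" using less.prems by simp
    then have "gcd t n = d \<or> gcd t n \<in> E" unfolding E_def by simp
    with t show "t \<in> ?A d \<union> (\<Union>e\<in>E. ?A e)" by blast
  next
    fix t assume t: "t \<in> ?A d \<union> (\<Union>e\<in>E. ?A e)"
    then have "t \<in> {1..n}" by blast
    moreover have "d dvd gcd t n" using t by (elim UnE UN_E) (simp_all add: E_def)
    ultimately show "t \<in> {t \<in> {1..n}. d dvd t}" by simp
  qed
  have "?s {t \<in> {1..n}. d dvd t} = ?s (?A d) + ?s (\<Union>e\<in>E. ?A e)"
    unfolding split using fin by (intro sum.union_disjoint) (auto simp: E_def)
  also have "?s (\<Union>e\<in>E. ?A e) = (\<Sum>e\<in>E. ?s (?A e))"
    using fin by (intro sum.UNION_disjoint) auto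
  finally have eq: "?s (?A d) = ?s {t \<in> {1..n}. d dvd t} - (\<Sum>e\<in>E. ?s (?A e))" by simp
  \<comment> \<open>The multiples are listed downwards from \<open>n\<close>, so that the index runs from \<open>0\<close>.\<close>
  have "?s {t \<in> {1..n}. d dvd t} = (\<Sum>i<m. zeta n (j * int (d * (m - i))))"
    by (rule sum.reindex_bij_witness[of _ "\<lambda>i. d * (m - i)" "\<lambda>t. m - t div d"])
       (use \<open>d > 0\<close> \<open>m > 0\<close> in \<open>auto simp: m elim!: dvdE\<close>)
  also have "\<dots> = (\<Sum>i<m. zeta m (int i * (- j)))"
  proof (rule sum.cong)
    fix i assume "i \<in> {..<m}"
    then have "zeta n (j * int (d * (m - i))) = zeta n (int d * (j * (int m - int i)))"
      by (simp add: mult_ac of_nat_diff)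
    also have "\<dots> = zeta m (j * (int m - int i))"
      unfolding m using \<open>d > 0\<close> by (rule zeta_scale)
    also have "\<dots> = zeta m (int i * (- j))"
      using \<open>m > 0\<close> by (intro zeta_cong) (auto simp: algebra_simps)
    finally show "zeta n (j * int (d * (m - i))) = zeta m (int i * (- j))" .
  qed simp
  also have "\<dots> \<in> \<int>"
    unfolding sum_zeta[OF \<open>m > 0\<close>] by simp
  finally have "?s {t \<in> {1..n}. d dvd t} \<in> \<int>" .
  then show ?case
    unfolding eq by (rule Ints_diff [OF _ Ints_sum [OF E_int]])
qed

lemma G_set_sum_int:
  assumes "n > 0" "d dvd n"
  shows "(\<Sum>t\<in>G_set n d. zeta n (j * int t)) \<in> \<int>"
proof (cases "d = n")
  case True
  have "t \<notin> G_set n n" for t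
  proof
    assume "t \<in> G_set n n"
    then have t: "1 \<le> t" "t \<le> n - 1" "gcd t n = n" by (auto simp: G_set_conv)
    then have "n dvd t" by (metis gcd_dvd1)
    with t assms(1) show False by (auto dest: dvd_imp_le)
  qed
  then have "G_set n d = {}" using True by blast
  then show ?thesis by simp
next
  case False
  then have "t \<in> G_set n d \<longleftrightarrow> t \<in> {1..n} \<and> gcd t n = d" for t
    using assms(1) by (cases "t = n") (auto simp: G_set_conv)
  then have "G_set n d = {t. t \<in> {1..n} \<and> gcd t n = d}" by blast
  then show ?thesis using Ramanujan_sum_int[OF assms, of j] by simp
qed

lemma finite_G_set [simp]: "finite (G_set n d)"
  by (rule finite_subset[of _ "{..n}"]) (auto simp: G_set_conv)

lemma hs_eig_by_gcd:
  assumes "n > 0" "0 \<notin> S"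
  shows "hs_eig n S j = (\<Sum>d | d dvd n. \<Sum>t\<in>G_set n d. hs_symbol n S (int t) * zeta n (j * int t))"
proof -
  have "{..<n} = insert 0 (\<Union>d\<in>{d. d dvd n}. G_set n d)"
    using assms(1) by (auto simp: G_set_conv)
  moreover have "hs_symbol n S 0 = 0"
    using assms(2) by (simp add: hs_symbol_def)
  moreover have "0 \<notin> (\<Union>d\<in>{d. d dvd n}. G_set n d)"
    by (auto simp: G_set_conv)
  ultimately have "hs_eig n S j = (\<Sum>t\<in>(\<Union>d\<in>{d. d dvd n}. G_set n d). hs_symbol n S (int t) * zeta n (j * int t))"
    using assms(1) by (simp add: hs_eig_def)
  also have "\<dots> = (\<Sum>d | d dvd n. \<Sum>t\<in>G_set n d. hs_symbol n S (int t) * zeta n (j * int t))"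
    using assms(1) by (intro sum.UNION_disjoint) (auto simp: G_set_conv)
  finally show ?thesis .
qed

section \<open>Sets of the described shape have integral eigenvalues\<close>

text \<open>
  On the class of \<open>d\<close>, the function that is \<open>hs_unit\<close> on one residue of the cofactor \<open>k\<close> modulo \<open>3\<close> and
  \<open>cnj hs_unit\<close> on the other is the negative of a character of \<open>\<int>\<^sub>n\<close>: the character takes the value
  \<open>zeta 3 (- (r * k))\<close> there, \<open>r * k \<equiv> r\<^sup>2 \<equiv> 1\<close> modulo \<open>3\<close> if \<open>k \<equiv> r\<close> and \<open>r * k \<equiv> - 1\<close> otherwise, and
  \<open>hs_unit = - zeta 3 (- 1)\<close>.
\<close>

lemma skew_symbol_conv_zeta:
  assumes "n > 0" "d dvd n" "3 dvd n div d" "r \<in> {1, 2}" "k mod 3 \<in> {1, 2}"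
  shows "- zeta n (- int (r * (n div d div 3)) * int (d * k)) = (if k mod 3 = r then hs_unit else cnj hs_unit)"
proof -
  obtain m where m: "n = d * (3 * m)" using assms(2,3) by (metis dvd_div_mult_self dvd_mult_div_cancel)
  then have dm: "d > 0" "m > 0" using assms(1) by auto
  have "n div d div 3 = m" using dm by (simp add: m)
  then have "zeta n (- int (r * (n div d div 3)) * int (d * k)) = zeta ((d * m) * 3) (int (d * m) * (- int (r * k)))"
    by (simp add: m mult_ac)
  also have "\<dots> = zeta 3 (- int (r * k))"
    using dm by (intro zeta_scale) auto
  also have "\<dots> = (if k mod 3 = r then zeta 3 (- 1) else cnj (zeta 3 (- 1)))"
  proof (cases "k mod 3 = r")
    case True
    then have "(r * k) mod 3 = 1" using assms(4) by auto presburger+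
    then have "3 dvd (- int (r * k)) - (- 1)" by presburger
    then show ?thesis using True zeta_cong[of 3 "- int (r * k)" "- 1"] by simp
  next
    case False
    then have "(r * k) mod 3 = 2" using assms(4,5) by auto presburger+
    then have "3 dvd (- int (r * k)) - 1" by presburger
    then show ?thesis using False zeta_cong[of 3 "- int (r * k)" 1] by (simp add: cnj_zeta)
  qed
  finally show ?thesis by (simp add: zeta_3_conv_hs_unit)
qed

lemma G_set_coprime:
  assumes "n > 0" "d * k \<in> G_set n d"
  shows "coprime k (n div d)"
  using G_setE[OF assms] by (metis mult_cancel1 not_gr_zero)

lemma G_set_cofactor_mod_3:
  assumes "n > 0" "d * k \<in> G_set n d" "3 dvd n div d"
  shows "k mod 3 \<in> {1, 2}"
proof -
  have "\<not> 3 dvd k"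
    using G_set_coprime[OF assms(1,2)] assms(3) coprime_common_divisor_nat[of k "n div d" 3] by auto
  then have "k mod 3 = 1 \<or> k mod 3 = 2" by presburger
  then show ?thesis by simp
qed

text \<open>
  When \<open>3\<close> divides \<open>n div d\<close>, negation in \<open>\<int>\<^sub>n\<close> exchanges the two halves \<open>G3_set n 1 d\<close> and
  \<open>G3_set n 2 d\<close> of a class.
\<close>

lemma G_set_reflect_cofactor:
  assumes "n > 0" "d * k \<in> G_set n d" "3 dvd n div d" "r \<in> {1, 2}" "k mod 3 \<noteq> r"
  obtains k' where "n - d * k = d * k'" "k' mod 3 = r"
proof
  let ?m = "n div d"
  obtain "d * k < n" "d dvd n" using G_setE[OF assms(1,2)] by metis
  then show "n - d * k = d * (?m - k)" by (simp add: diff_mult_distrib2)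
  have "d * k < d * ?m" using \<open>d * k < n\<close> \<open>d dvd n\<close> by simp
  then have "k < ?m" by simp
  then have "(k mod 3 + (?m - k) mod 3) mod 3 = 0"
    using assms(3) by (simp add: mod_add_eq)
  moreover have "(?m - k) mod 3 = 0 \<or> (?m - k) mod 3 = 1 \<or> (?m - k) mod 3 = 2"
    by linarith
  ultimately show "(?m - k) mod 3 = r"
    using assms(4,5) G_set_cofactor_mod_3[OF assms(1-3)] by (auto simp del: One_nat_def)
qed

text \<open>
  The class of a proper divisor \<open>d\<close> contributes a Ramanujan sum if \<open>d \<in> D1\<close>, the negative of a
  Ramanujan sum with shifted index if \<open>d \<in> D2\<close>, and \<open>0\<close> otherwise; \<open>G_set n n\<close> is empty.
\<close>

lemma hs_eig_int_if_gcd_classes: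
  fixes n :: nat
  assumes "n > 0" "0 \<notin> S"
    and D2: "D2 \<subseteq> {d. 3 dvd n \<and> d dvd n div 3}"
    and Sn: "\<forall>d\<in>D2. Sn d \<in> {G3_set n 1 d, G3_set n 2 d}"
    and sym: "S - skew_part n S = (\<Union>d\<in>D1. G_set n d)"
    and skew: "skew_part n S = (\<Union>d\<in>D2. Sn d)"
  shows "hs_eig n S j \<in> \<int>"
proof -
  have sub: "Sn d \<subseteq> G_set n d" if "d \<in> D2" for d
    using Sn that G3_set_subset by blast
  have gcd: "gcd t n = d" if "t \<in> G_set n d" for t d
    using that by (simp add: G_set_conv)
  have sym_iff: "t \<in> S - skew_part n S \<longleftrightarrow> d \<in> D1" if "t \<in> G_set n d" for t d
    unfolding sym using that gcd by auto
  have skew_iff: "t \<in> skew_part n S \<longleftrightarrow> d \<in> D2 \<and> t \<in> Sn d" if "t \<in> G_set n d" for t d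
    unfolding skew using that gcd sub by blast
  have "(\<Sum>t\<in>G_set n d. hs_symbol n S (int t) * zeta n (j * int t)) \<in> \<int>" if d: "d dvd n" for d
  proof -
    consider "d \<in> D1" | "d \<in> D2" "d \<notin> D1" | "d \<notin> D1" "d \<notin> D2" by blast
    then show ?thesis
    proof cases
      case 1
      have "hs_symbol n S (int t) = 1" if "t \<in> G_set n d" for t
        using that 1 sym_iff sym_part_iff_hs_symbol[of t n S] assms(1) by (auto simp: G_set_conv)
      then show ?thesis using G_set_sum_int[OF assms(1) d] by simp
    next
      case 2
      obtain r :: nat where r: "r \<in> {1, 2}" "Sn d = G3_set n r d" using Sn 2 by blast
      have "3 dvd n" "d dvd n div 3" using D2 2 by auto
      then obtain x where "n = 3 * (d * x)" by (metis dvdE dvd_mult_div_cancel)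
      then have m3: "3 dvd n div d" using assms(1) by simp
      \<comment> \<open>Multiplication by the character that represents the symbol shifts the index \<open>j\<close> to \<open>s\<close>.\<close>
      define s where "s = j - int (r * (n div d div 3))"
      have "hs_symbol n S (int t) * zeta n (j * int t) = - zeta n (s * int t)"
        if t: "t \<in> G_set n d" for t
      proof -
        obtain k where k: "t = d * k" "t < n" "d > 0" "coprime k (n div d)" "k > 0"
          using G_setE[OF assms(1) t] by metis
        have k3: "k mod 3 \<in> {1, 2}"
          using G_set_cofactor_mod_3[OF assms(1) _ m3] t k(1) by blast
        have "hs_symbol n S (int t) = (if k mod 3 = r then hs_unit else cnj hs_unit)"
        proof (cases "k mod 3 = r")
          case True
          then have "t \<in> Sn d" using t k r by (auto simp: G3_set_conv)
          then have "t \<in> skew_part n S" using skew_iff t 2 by blast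
          then show ?thesis using True k(2) by (simp add: skew_part_iff_hs_symbol)
        next
          case False
          then obtain k' where "n - t = d * k'" "k' mod 3 = r"
            using G_set_reflect_cofactor[OF assms(1) _ m3 r(1)] t k(1) by metis
          then have "n - t \<in> Sn d"
            using G_set_reflect[OF t] k(3) r by (auto simp: G3_set_conv)
          then have "n - t \<in> skew_part n S" using skew_iff[OF G_set_reflect[OF t]] 2 by blast
          moreover have "n - t < n" using k(1,3,5) assms(1) by simp
          ultimately have "hs_symbol n S (int (n - t)) = hs_unit"
            using skew_part_iff_hs_symbol by blast
          moreover have "hs_symbol n S (int (n - t)) = hs_symbol n S (- int t)"
            using k(2) by (intro hs_symbol_cong) (simp add: of_nat_diff mod_eq_dvd_iff)
          ultimately have "hs_symbol n S (int t) = cnj hs_unit"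
            by (metis complex_cnj_cnj hs_symbol_minus)
          then show ?thesis using False by simp
        qed
        also have "\<dots> = - zeta n (- int (r * (n div d div 3)) * int t)"
          using skew_symbol_conv_zeta[OF assms(1) d m3 r(1) k3] k(1) by simp
        finally show ?thesis
          by (simp add: s_def left_diff_distrib algebra_simps flip: zeta_add)
      qed
      then have "(\<Sum>t\<in>G_set n d. hs_symbol n S (int t) * zeta n (j * int t))
          = - (\<Sum>t\<in>G_set n d. zeta n (s * int t))"
        by (simp add: sum_negf)
      then show ?thesis using G_set_sum_int[OF assms(1) d, of s] by simp
    next
      case 3
      have S: "t \<notin> S" if "t \<in> G_set n d" for t
        using sym_iff[OF that] skew_iff[OF that] 3 by auto
      have "hs_symbol n S (int t) = 0" if t: "t \<in> G_set n d" for t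
      proof -
        have "- int t mod int n = int (n - t) mod int n"
        proof -
          have "int (n - t) = int n - int t" using t assms(1) by (auto simp: G_set_conv of_nat_diff)
          then show ?thesis by simp
        qed
        also have "\<dots> = int (n - t)"
          using t assms(1) by (intro mod_pos_pos_trivial) (auto simp: G_set_conv)
        finally have "nat (- int t mod int n) = n - t" by simp
        then show ?thesis
          using S[OF t] S[OF G_set_reflect[OF t]] t assms(1)
          by (auto simp: hs_symbol_def G_set_conv)
      qed
      then show ?thesis by simp
    qed
  qed
  then show ?thesis
    unfolding hs_eig_by_gcd[OF assms(1,2)] by (intro Ints_sum [of "{d. d dvd n}"]) simp
qed

section \<open>Integral eigenvalues force the described shape\<close>

text \<open>
  The units modulo \<open>n div d\<close> act transitively on the class of \<open>d\<close>.  The congruence between the cofactors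
  is kept because it controls \<open>a\<close> modulo \<open>3\<close> whenever \<open>3\<close> divides \<open>n div d\<close>.
\<close>

lemma hs_symbol_on_G_set:
  assumes "n > 0" and int: "\<forall>j<n. hs_eig n S (int j) \<in> \<int>"
    and t: "d * k \<in> G_set n d" and u: "d * k' \<in> G_set n d"
  obtains a where "coprime a 6" "[a * k = k'] (mod n div d)"
    "hs_symbol n S (int (d * k')) = hs_symbol n S (int (d * k)) ^ a"
proof -
  have d: "d > 0" "d dvd n" using G_setE[OF assms(1) t] by metis+
  have "coprime k (n div d)" "coprime k' (n div d)"
    using G_set_coprime[OF assms(1)] t u by blast+
  then obtain a where a: "coprime a (6 * n)" "[a * k = k'] (mod n div d)"
    using unit_transport[of k "n div d" k' "6 * n"] assms(1) by auto
  have "[d * (a * k) = d * k'] (mod d * (n div d))"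
    using a(2) by (simp only: cong_def mod_mult_mult1)
  then have "[int (d * (a * k)) = int (d * k')] (mod int n)"
    using d(2) by (simp only: cong_int_iff dvd_mult_div_cancel)
  then have "hs_symbol n S (int (d * k')) = hs_symbol n S (int a * int (d * k))"
    by (intro hs_symbol_cong) (simp add: cong_def mult_ac)
  then show thesis
    using that[of a] a hs_symbol_mult_coprime[OF assms(1) int a(1)] by simp
qed

lemma hs_symbol_eq_1_on_G_set:
  assumes "n > 0" and "\<forall>j<n. hs_eig n S (int j) \<in> \<int>"
    and "t \<in> G_set n d" "u \<in> G_set n d" and "hs_symbol n S (int t) = 1"
  shows "hs_symbol n S (int u) = 1"
proof -
  obtain k k' where "t = d * k" "u = d * k'"
    using assms(3,4) by (metis G_setE assms(1))
  then show ?thesis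
    using hs_symbol_on_G_set[OF assms(1,2)] assms(3-5) by (metis power_one)
qed

text \<open>
  Otherwise the residue of a unit modulo \<open>3\<close> is independent of its residue modulo \<open>n div d\<close>.  Hence some
  \<open>a\<close> fixes \<open>t\<close> modulo \<open>n\<close>, although the \<open>a\<close>-th power conjugates the symbol.
\<close>

lemma skew_imp_three_dvd:
  assumes "n > 0" and int: "\<forall>j<n. hs_eig n S (int j) \<in> \<int>"
    and t: "t \<in> G_set n d" and c: "hs_symbol n S (int t) = hs_unit"
  shows "3 dvd n div d"
proof (rule ccontr)
  assume not3: "\<not> 3 dvd n div d"
  have d: "d > 0" "d dvd n" "d dvd t" using G_setE[OF assms(1) t] by (metis dvd_triv_left)+
  have cop: "coprime (n div d) 3"
    using not3 prime_imp_coprime[of 3 "n div d"] by (simp add: coprime_commute)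
  obtain x where x: "[x = 1] (mod n div d)" "[x = 2] (mod 3)"
    using binary_chinese_remainder_nat[OF cop] by blast
  have "coprime x (n div d * 3)"
    using cong_imp_coprime[OF cong_sym[OF x(1)]] cong_imp_coprime[OF cong_sym[OF x(2)]]
    by (simp add: coprime_commute)
  then obtain a where a: "[a = x] (mod n div d * 3)" "coprime a (6 * n)"
    using coprime_lift[of x "n div d * 3" "6 * n"] assms(1) by auto
  have "[a = 1] (mod n div d)" "[a = 2] (mod 3)"
    using cong_modulus_mult_nat[OF a(1)] x a(1) by (metis cong_trans cong_modulus_mult_nat mult.commute)+
  then have "a mod 3 = 2" by (simp add: cong_def)
  have "[a * t = 1 * t] (mod n)"
  proof -
    obtain k where k: "t = d * k" using d(3) by (elim dvdE)
    have "[d * a = d * 1] (mod d * (n div d))"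
      using \<open>[a = 1] (mod n div d)\<close> by (simp only: cong_def mod_mult_mult1)
    then have "[d * a * k = d * 1 * k] (mod n)"
      using d(2) by (intro cong_scalar_right) simp
    then show ?thesis by (simp add: k mult_ac)
  qed
  then have "[int (a * t) = int t] (mod int n)" by (simp only: cong_int_iff mult_1)
  then have "hs_symbol n S (int a * int t) = hs_symbol n S (int t)"
    by (intro hs_symbol_cong) (simp add: cong_def)
  moreover have "hs_symbol n S (int a * int t) = cnj (hs_symbol n S (int t))"
    using hs_symbol_mult_coprime[OF assms(1) int a(2), of "int t"]
      hs_values_power[OF hs_symbol_in_hs_values[of n S "int t"], of a] a(2) \<open>a mod 3 = 2\<close> by simp
  ultimately show False using c hs_unit_distinct by simp
qed

lemma skew_on_G3_set:
  assumes "n > 0" and int: "\<forall>j<n. hs_eig n S (int j) \<in> \<int>"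
    and t: "d * k \<in> G_set n d" and c: "hs_symbol n S (int (d * k)) = hs_unit"
    and u: "d * k' \<in> G_set n d" and kk': "k mod 3 = k' mod 3"
  shows "hs_symbol n S (int (d * k')) = hs_unit"
proof -
  have m3: "3 dvd n div d" by (rule skew_imp_three_dvd[OF assms(1) int t c])
  obtain a where a: "coprime a 6" "[a * k = k'] (mod n div d)"
    "hs_symbol n S (int (d * k')) = hs_symbol n S (int (d * k)) ^ a"
    using hs_symbol_on_G_set[OF assms(1) int t u] .
  have "coprime k (n div d)" by (rule G_set_coprime[OF assms(1) t])
  then have "coprime k 3" using m3 by (metis coprime_mult_right_iff dvdE)
  have "[a * k = k'] (mod 3)" using a(2) m3 by (rule cong_dvd_modulus_nat)
  then have "[a * k = 1 * k] (mod 3)" using kk' by (simp add: cong_def)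
  then have "[a = 1] (mod 3)" using \<open>coprime k 3\<close> by (metis cong_mult_rcancel_nat)
  then show ?thesis
    using hs_values_power[OF hs_symbol_in_hs_values[of n S "int (d * k)"] a(1)] a(3) c
    by (simp add: cong_def)
qed

text \<open>
  The index sets are the greatest common divisors that occur in the two parts of \<open>S\<close>.  The skew part of
  a class fills the half of one residue, by \<open>skew_on_G3_set\<close>, and avoids the other: the negative of an
  element there would lie in the filled half, so an element of the skew part and its negative would
  both belong to \<open>S\<close>.
\<close>

lemma gcd_classes_if_hs_eig_int:
  fixes n :: nat
  assumes "n > 0" "S \<subseteq> {0..<n}" "0 \<notin> S"
    and int: "\<forall>j<n. hs_eig n S (int j) \<in> \<int>"
  shows "\<exists>D1 D2 :: nat set. \<exists>Sn :: nat \<Rightarrow> nat set.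
       D1 \<subseteq> {d. d dvd n} \<and>
       D2 \<subseteq> {d. 3 dvd n \<and> d dvd n div 3} \<and>
       D1 \<inter> D2 = {} \<and>
       (\<forall>d\<in>D2. Sn d \<in> {G3_set n 1 d, G3_set n 2 d}) \<and>
       S - skew_part n S = (\<Union>d\<in>D1. G_set n d) \<and>
       skew_part n S = (if 3 dvd n then (\<Union>d\<in>D2. Sn d) else {})"
proof -
  define D1 where "D1 = (\<lambda>t. gcd t n) ` (S - skew_part n S)"
  define D2 where "D2 = (\<lambda>t. gcd t n) ` skew_part n S"
  define Sn where "Sn d = G_set n d \<inter> skew_part n S" for d
  have S: "t \<in> G_set n (gcd t n)" "t < n" if "t \<in> S" for t
    using that assms(2,3) by (auto simp: G_set_conv Suc_le_eq intro: gr0I)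
  have skewS: "skew_part n S \<subseteq> S" by (auto simp: skew_part_def)
  have less: "t < n" if "t \<in> G_set n d" for t d
    using that assms(1) by (auto simp: G_set_conv)
  have sym: "u \<in> S - skew_part n S" if "t \<in> S - skew_part n S" "u \<in> G_set n (gcd t n)" for t u
  proof -
    have "t \<in> S" using that(1) by blast
    then have "hs_symbol n S (int t) = 1"
      using sym_part_iff_hs_symbol[OF S(2)] that(1) by blast
    then have "hs_symbol n S (int u) = 1"
      by (rule hs_symbol_eq_1_on_G_set[OF assms(1) int S(1)[OF \<open>t \<in> S\<close>] that(2)])
    then show ?thesis
      using sym_part_iff_hs_symbol[OF less[OF that(2)]] by blast
  qed
  have three: "3 dvd n div gcd t n" if "t \<in> skew_part n S" for t
    using skew_imp_three_dvd[OF assms(1) int S(1)] that skewS S(2) skew_part_iff_hs_symbol by blast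
  have "D1 \<subseteq> {d. d dvd n}" by (auto simp: D1_def)
  moreover have "D2 \<subseteq> {d. 3 dvd n \<and> d dvd n div 3}"
  proof -
    have "3 dvd n \<and> d dvd n div 3" if de: "d dvd n" "3 dvd n div d" for d
    proof -
      obtain x where x: "n div d = 3 * x" using de(2) by (elim dvdE)
      have "n = d * (3 * x)" unfolding x [symmetric] using de(1) by simp
      then show ?thesis by simp
    qed
    then show ?thesis using three by (auto simp: D2_def)
  qed
  moreover have "D1 \<inter> D2 = {}"
  proof -
    have False if t: "t \<in> S - skew_part n S" "u \<in> skew_part n S" "gcd t n = gcd u n" for t u
      using sym[OF t(1)] t S(1)[of u] skewS by auto
    then show ?thesis by (auto simp: D1_def D2_def)
  qed
  moreover have "\<forall>d\<in>D2. Sn d \<in> {G3_set n 1 d, G3_set n 2 d}"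
  proof
    fix d assume "d \<in> D2"
    \<comment> \<open>Any witness \<open>t\<close> decides the residue class that the skew part occupies.\<close>
    then obtain t where t: "t \<in> skew_part n S" "gcd t n = d" by (auto simp: D2_def)
    then have tG: "t \<in> G_set n d" using S skewS by blast
    then obtain k where k: "t = d * k" "t < n" "d > 0" "d dvd n" "coprime k (n div d)"
      using G_setE[OF assms(1)] by metis
    have m3: "3 dvd n div d" using three t by blast
    have k3: "k mod 3 \<in> {1, 2}"
      using G_set_cofactor_mod_3[OF assms(1) _ m3] tG k(1) by blast
    have c: "hs_symbol n S (int t) = hs_unit" using t(1) k(2) skew_part_iff_hs_symbol by blast
    have eq: "Sn d = G3_set n (k mod 3) d"
    proof (intro equalityI subsetI)
      fix u assume u: "u \<in> G3_set n (k mod 3) d"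
      then obtain k' where k': "u = d * k'" "k' mod 3 = k mod 3" by (auto simp: G3_set_def)
      have uG: "u \<in> G_set n d" using u G3_set_subset by blast
      have "hs_symbol n S (int u) = hs_unit"
        using skew_on_G3_set[OF assms(1) int, of d k k'] tG uG c k k' by simp
      then show "u \<in> Sn d" using uG less by (simp add: Sn_def skew_part_iff_hs_symbol)
    next
      fix u assume "u \<in> Sn d"
      then have uG: "u \<in> G_set n d" and us: "u \<in> skew_part n S" by (auto simp: Sn_def)
      then obtain k' where k': "u = d * k'" "u < n" "0 < k'" using G_setE[OF assms(1)] by metis
      show "u \<in> G3_set n (k mod 3) d"
      proof (rule ccontr)
        assume "u \<notin> G3_set n (k mod 3) d"
        then have neq: "k' mod 3 \<noteq> k mod 3" using uG k' k(3) by (auto simp: G3_set_conv)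
        obtain k'' where k'': "n - u = d * k''" "k'' mod 3 = k mod 3"
          using G_set_reflect_cofactor[OF assms(1) _ m3 k3 neq] uG k'(1) by metis
        have nuG: "n - u \<in> G_set n d" using uG by (rule G_set_reflect)
        have "hs_symbol n S (int (n - u)) = hs_unit"
          using skew_on_G3_set[OF assms(1) int, of d k k''] tG nuG c k(1) k'' by simp
        then have "n - u \<in> S"
          using less[OF nuG] skewS skew_part_iff_hs_symbol by blast
        moreover have "zn_neg n u = n - u"
          using k' k(3) assms(1) by (simp add: zn_neg_def zn_minus_def)
        ultimately show False using us by (simp add: skew_part_def)
      qed
    qed
    have "k mod 3 = 1 \<or> k mod 3 = 2" using k3 by blast
    then show "Sn d \<in> {G3_set n 1 d, G3_set n 2 d}"
      unfolding eq by (elim disjE) (simp_all only: insert_iff simp_thms)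
  qed
  moreover have "S - skew_part n S = (\<Union>d\<in>D1. G_set n d)"
  proof (intro equalityI subsetI)
    fix t assume t: "t \<in> S - skew_part n S"
    then have "t \<in> G_set n (gcd t n)" using S(1) by blast
    with t show "t \<in> (\<Union>d\<in>D1. G_set n d)" unfolding D1_def by blast
  next
    fix u assume "u \<in> (\<Union>d\<in>D1. G_set n d)"
    then show "u \<in> S - skew_part n S" unfolding D1_def using sym by blast
  qed
  moreover have "skew_part n S = (if 3 dvd n then (\<Union>d\<in>D2. Sn d) else {})"
  proof -
    have "3 dvd n" if "t \<in> skew_part n S" for t
      using dvd_mult[OF three[OF that], of "gcd t n"] by simp
    moreover have "skew_part n S = (\<Union>d\<in>D2. Sn d)"
    proof (intro equalityI subsetI)
      fix t assume t: "t \<in> skew_part n S"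
      then have "t \<in> Sn (gcd t n)" unfolding Sn_def using S(1) skewS by blast
      with t show "t \<in> (\<Union>d\<in>D2. Sn d)" unfolding D2_def by blast
    qed (auto simp: Sn_def)
    ultimately show ?thesis by (cases "3 dvd n") auto
  qed
  ultimately show ?thesis by blast
qed

theorem theorem4p7:
  fixes n :: nat and S :: "nat set"
  assumes "n \<ge> 2" and "S \<subseteq> {0..<n}" and "0 \<notin> S"
  shows "HS_integral (circ n S) \<longleftrightarrow>
    (\<exists>D1 D2 :: nat set. \<exists>Sn :: nat \<Rightarrow> nat set.
       D1 \<subseteq> {d. d dvd n} \<and>
       D2 \<subseteq> {d. 3 dvd n \<and> d dvd n div 3} \<and>
       D1 \<inter> D2 = {} \<and>
       (\<forall>d\<in>D2. Sn d \<in> {G3_set n 1 d, G3_set n 2 d}) \<and>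
       S - skew_part n S = (\<Union>d\<in>D1. G_set n d) \<and>
       skew_part n S = (if 3 dvd n then (\<Union>d\<in>D2. Sn d) else {}))"
    (is "_ \<longleftrightarrow> ?R")
proof
  have "n > 0" using assms(1) by simp
  {
    assume "HS_integral (circ n S)"
    then show ?R
      using gcd_classes_if_hs_eig_int[OF \<open>n > 0\<close> assms(2,3)] HS_integral_circ_iff[OF \<open>n > 0\<close>] by blast
  next
    assume ?R
    then obtain D1 D2 Sn where D:
      "D1 \<subseteq> {d. d dvd n}" "D2 \<subseteq> {d. 3 dvd n \<and> d dvd n div 3}" "D1 \<inter> D2 = {}"
      "\<forall>d\<in>D2. Sn d \<in> {G3_set n 1 d, G3_set n 2 d}"
      "S - skew_part n S = (\<Union>d\<in>D1. G_set n d)"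
      "skew_part n S = (if 3 dvd n then (\<Union>d\<in>D2. Sn d) else {})"
      by (elim exE conjE) (rule that)
    have "skew_part n S = (\<Union>d\<in>D2. Sn d)" using D(2,6) by (cases "3 dvd n") auto
    then show "HS_integral (circ n S)"
      using hs_eig_int_if_gcd_classes[OF \<open>n > 0\<close> assms(3) D(2,4,5)] HS_integral_circ_iff[OF \<open>n > 0\<close>] by blast
  }
qed

end
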